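(* Let $N=\mathsf p_1[\![P_1]\!]\parallel\cdots\parallel\mathsf p_n[\![P_n]\!]$ be a network. Then $\vdash \mathrm{gt}(N,\mathsf p_1\cdots\mathsf p_n)\triangleright N$.
   Context: Participants are ranged over by $\mathsf p,\mathsf q,\mathsf r$ and labels by $\lambda$. Processes are the possibly infinite but regular (finitely many distinct subterms) terms coinductively generated by $P ::= \mathbf 0 \mid \mathsf p!\{\lambda_i;P_i\}_{i\in I}\mid \mathsf p?\{\lambda_i;P_i\}_{i\in I}$, with $I$ finite and nonempty and the $\lambda_i$ pairwise distinct ($\mathsf p!\{\ldots\}$ is a choice of outputs to $\mathsf p$, $\mathsf p?\{\ldots\}$ a choice of inputs from $\mathsf p$). A network is $N=\mathsf p_1[\![P_1]\!]\parallel\cdots\parallel\mathsf p_n[\![P_n]\!]$ with $n>0$ and pairwise distinct $\mathsf p_i$; networks are taken modulo permutation of components and adding/removing components $\mathsf p[\![\mathbf 0]\!]$. We write $\mathsf p[\![P]\!]\in N$ (for $P\neq\mathbf 0$) if $N\equiv\mathsf p[\![P]\!]\parallel N'$, and $\mathrm{plays}(N)=\{\mathsf p\mid\mathsf p[\![P]\!]\in N\}$. Global types are the possibly infinite regular terms coinductively generated by $G ::= \mathsf{End}\mid \mathsf p\mathsf q!\{\lambda_i;G_i\}_{i\in I}\mid\mathsf p\mathsf q?\{\lambda_i;G_i\}_{i\in I}$ with $I$ finite nonempty, $\mathsf p\neq\mathsf q$, the $\lambda_i$ pairwise distinct (singleton choices are written $\mathsf p\mathsf q!\lambda;G$, $\mathsf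 p\mathsf q?\lambda;G$). Set $\mathrm{play}(\mathsf p\mathsf q!\{\ldots\})=\mathsf p$, $\mathrm{play}(\mathsf p\mathsf q?\{\ldots\})=\mathsf q$; $\mathrm{plays}(G)$ is the least set with $\mathrm{plays}(\mathsf{End})=\emptyset$ and $\mathrm{plays}(G)=\{\mathrm{play}(G)\}\cup\bigcup_{i\in I}\mathrm{plays}(G_i)$ for $G$ a choice with continuations $G_i$. The typing judgement $\vdash G\triangleright N$ is defined coinductively (derivations may be infinite) by: (End) $\vdash\mathsf{End}\triangleright\mathsf p[\![\mathbf 0]\!]$; (Out) if for all $i\in I$, $\vdash G_i\triangleright\mathsf p[\![P_i]\!]\parallel N$ and $\mathrm{plays}(G_i)\setminus\{\mathsf p\}=\mathrm{plays}(N)$, then $\vdash\mathsf p\mathsf q!\{\lambda_i;G_i\}_{i\in I}\triangleright\mathsf p[\![\mathsf q!\{\lambda_i;P_i\}_{i\in I}]\!]\parallel N$; (In) if $I\subseteq J$ and for all $i\in I$, $\vdash G_i\triangleright\mathsf p[\![P_i]\!]\parallel N$ and $\mathrm{plays}(G_i)\setminus\{\mathsf p\}=\mathrm{plays}(N)$, then $\vdash\mathsf q\mathsf p?\{\lambda_i;G_i\}_{i\in I}\triangleright\mathsf p[\![\mathsf q?\{\lambda_j;P_j\}_{j\in J}]\!]\parallel N$. Fix a total order $\preceq$ on labels. For a network $N$ and a finite list $\pi$ of participants ($\epsilon$ the empty list, $\cdot$ concatenation), the global type $\mathrm{gt}(N,\pi)$ is defined corecursively by: $\mathrm{gt}(N,\epsilon)=\mathsf{End}$;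 $\mathrm{gt}(N,\mathsf p\cdot\pi)=\mathrm{gt}(N',\pi)$ if $N\equiv\mathsf p[\![\mathbf 0]\!]\parallel N'$; $\mathrm{gt}(N,\mathsf p\cdot\pi)=\mathsf p\mathsf q!\{\lambda_i;\mathrm{gt}(\mathsf p[\![P_i]\!]\parallel N',\pi\cdot\mathsf p)\}_{i\in I}$ if $N\equiv\mathsf p[\![\mathsf q!\{\lambda_i;P_i\}_{i\in I}]\!]\parallel N'$; $\mathrm{gt}(N,\mathsf p\cdot\pi)=\mathsf q\mathsf p?\lambda_k;\mathrm{gt}(\mathsf p[\![P_k]\!]\parallel N',\pi\cdot\mathsf p)$ if $N\equiv\mathsf p[\![\mathsf q?\{\lambda_i;P_i\}_{i\in I}]\!]\parallel N'$, where $k\in I$ and $\lambda_k\preceq\lambda_i$ for all $i\in I$. *)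

theory Defs
  imports "HOL-Library.Finite_Map" "HOL-Library.Poly_Mapping" "HOL-Library.BNF_Corec"
begin

text \<open>
  A choice \<open>{\<lambda>\<^sub>i; X\<^sub>i}\<close> with finite index set and pairwise distinct labels is a finite map from
  labels to continuations. The codatatypes below are pre-terms: nonemptiness of the choices,
  regularity and (for global types) the distinctness of the two participants of a communication
  are imposed by the predicates \<open>process\<close> and \<open>global_type\<close>.
\<close>

codatatype ('p, 'l) proc =
    Inact
  | Send 'p "('l, ('p, 'l) proc) fmap"
  | Recv 'p "('l, ('p, 'l) proc) fmap"

codatatype ('p, 'l) gtype =
    End
  | GOut 'p 'p "('l, ('p, 'l) gtype) fmap"
  | GIn 'p 'p "('l, ('p, 'l) gtype) fmap"

inductive subproc :: "('p, 'l) proc \<Rightarrow> ('p, 'l) proc \<Rightarrow> bool" where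
  subproc_refl: "subproc P P"
| subproc_Send: "fmlookup Ps l = Some P \<Longrightarrow> subproc Q P \<Longrightarrow> subproc Q (Send p Ps)"
| subproc_Recv: "fmlookup Ps l = Some P \<Longrightarrow> subproc Q P \<Longrightarrow> subproc Q (Recv p Ps)"

definition process :: "('p, 'l) proc \<Rightarrow> bool" where
  "process P \<longleftrightarrow> finite {Q. subproc Q P} \<and>
     (\<forall>p Ps. subproc (Send p Ps) P \<or> subproc (Recv p Ps) P \<longrightarrow> Ps \<noteq> fmempty)"

definition partners :: "('p, 'l) proc \<Rightarrow> 'p set" where
  "partners P = {p. \<exists>Ps. subproc (Send p Ps) P \<or> subproc (Recv p Ps) P}"

inductive subgtype :: "('p, 'l) gtype \<Rightarrow> ('p, 'l) gtype \<Rightarrow> bool" where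
  subgtype_refl: "subgtype G G"
| subgtype_GOut: "fmlookup Gs l = Some G \<Longrightarrow> subgtype H G \<Longrightarrow> subgtype H (GOut p q Gs)"
| subgtype_GIn: "fmlookup Gs l = Some G \<Longrightarrow> subgtype H G \<Longrightarrow> subgtype H (GIn p q Gs)"

definition global_type :: "('p, 'l) gtype \<Rightarrow> bool" where
  "global_type G \<longleftrightarrow> finite {H. subgtype H G} \<and>
     (\<forall>p q Gs. subgtype (GOut p q Gs) G \<or> subgtype (GIn p q Gs) G \<longrightarrow> p \<noteq> q \<and> Gs \<noteq> fmempty)"

text \<open>
  In \<open>GOut p q Gs\<close> and \<open>GIn p q Gs\<close> messages go from \<open>p\<close> to \<open>q\<close>, so \<open>q\<close> is the player of the latter.
\<close>

inductive in_plays :: "'p \<Rightarrow> ('p, 'l) gtype \<Rightarrow> bool" where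
  "in_plays p (GOut p q Gs)"
| "in_plays q (GIn p q Gs)"
| "fmlookup Gs l = Some G \<Longrightarrow> in_plays r G \<Longrightarrow> in_plays r (GOut p q Gs)"
| "fmlookup Gs l = Some G \<Longrightarrow> in_plays r G \<Longrightarrow> in_plays r (GIn p q Gs)"

definition gplays :: "('p, 'l) gtype \<Rightarrow> 'p set" where
  "gplays G = {p. in_plays p G}"

text \<open>
  Networks modulo permutation of components and adding or removing components with the inactive
  process are the functions from participants to processes that are \<open>Inact\<close> almost everywhere.
  With \<open>Inact\<close> as zero, \<open>keys\<close> is the set of participants of the network, and the zero network is
  the class of every \<open>p[Inact]\<close>.
\<close>

instantiation proc :: (type, type) zero
begin
definition zero_proc_def: "0 = Inact"
instance ..
end

type_synonym ('p, 'l) network = "'p \<Rightarrow>\<^sub>0 ('p, 'l) proc"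

abbreviation nplays :: "('p, 'l) network \<Rightarrow> 'p set" where
  "nplays N \<equiv> Poly_Mapping.keys N"

text \<open>
  \<open>p\<lbrakk>P\<rbrakk> \<parallel> N\<close> is the parallel composition only if \<open>p \<notin> nplays N\<close>; in general it replaces the
  component of \<open>p\<close> in \<open>N\<close>.
\<close>

abbreviation par :: "'p \<Rightarrow> ('p, 'l) proc \<Rightarrow> ('p, 'l) network \<Rightarrow> ('p, 'l) network"
    ("_\<lbrakk>_\<rbrakk> \<parallel> _" [1000, 0, 65] 65) where
  "p\<lbrakk>P\<rbrakk> \<parallel> N \<equiv> Poly_Mapping.update p P N"

fun net :: "('p \<times> ('p, 'l) proc) list \<Rightarrow> ('p, 'l) network" where
  "net [] = 0"
| "net ((p, P) # C) = p\<lbrakk>P\<rbrakk> \<parallel> net C"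

coinductive typing :: "('p, 'l) gtype \<Rightarrow> ('p, 'l) network \<Rightarrow> bool"  ("\<turnstile> _ \<triangleright> _" [51, 51] 50) where
  typing_End: "\<turnstile> End \<triangleright> p\<lbrakk>Inact\<rbrakk> \<parallel> 0"
| typing_Out:
    "\<lbrakk>p \<notin> nplays N; Gs \<noteq> fmempty; fmdom Gs = fmdom Ps;
      \<And>l G P. fmlookup Gs l = Some G \<Longrightarrow> fmlookup Ps l = Some P \<Longrightarrow>
        (\<turnstile> G \<triangleright> p\<lbrakk>P\<rbrakk> \<parallel> N) \<and> gplays G - {p} = nplays N\<rbrakk>
     \<Longrightarrow> \<turnstile> GOut p q Gs \<triangleright> p\<lbrakk>Send q Ps\<rbrakk> \<parallel> N"
| typing_In:
    "\<lbrakk>p \<notin> nplays N; Gs \<noteq> fmempty; fmdom Gs |\<subseteq>| fmdom Ps;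
      \<And>l G P. fmlookup Gs l = Some G \<Longrightarrow> fmlookup Ps l = Some P \<Longrightarrow>
        (\<turnstile> G \<triangleright> p\<lbrakk>P\<rbrakk> \<parallel> N) \<and> gplays G - {p} = nplays N\<rbrakk>
     \<Longrightarrow> \<turnstile> GIn q p Gs \<triangleright> p\<lbrakk>Recv q Ps\<rbrakk> \<parallel> N"

corecursive gt :: "('p, 'l::linorder) network \<Rightarrow> 'p list \<Rightarrow> ('p, 'l) gtype" where
  "gt N ps = (case ps of
     [] \<Rightarrow> End
   | p # qs \<Rightarrow>
      (case Poly_Mapping.lookup N p of
         Inact \<Rightarrow> gt N qs
       | Send q Ps \<Rightarrow> GOut p q (fmmap (\<lambda>P. gt (p\<lbrakk>P\<rbrakk> \<parallel> N) (qs @ [p])) Ps)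
       | Recv q Ps \<Rightarrow> GIn q p (fmmap (\<lambda>P. gt (p\<lbrakk>P\<rbrakk> \<parallel> N) (qs @ [p]))
                               (fmrestrict_set {Min (fmdom' Ps)} Ps))))"
  by (relation "measure (length \<circ> snd)") auto

text \<open>The defining equations one by one; an input choice is cut down to its least label.\<close>

lemma gt_Nil: "gt N [] = End"
  by (subst gt.code) simp

lemma gt_Inact: "Poly_Mapping.lookup N p = Inact \<Longrightarrow> gt N (p # qs) = gt N qs"
  by (subst gt.code) simp

lemma gt_Send:
  assumes "p \<notin> nplays N"
  shows "gt (p\<lbrakk>Send q Ps\<rbrakk> \<parallel> N) (p # qs) =
    GOut p q (fmmap (\<lambda>P. gt (p\<lbrakk>P\<rbrakk> \<parallel> N) (qs @ [p])) Ps)"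
proof -
  have "p\<lbrakk>P\<rbrakk> \<parallel> (p\<lbrakk>Send q Ps\<rbrakk> \<parallel> N) = p\<lbrakk>P\<rbrakk> \<parallel> N" for P
    by (rule poly_mapping_eqI) (simp add: lookup_update)
  then show ?thesis by (subst gt.code) (simp add: lookup_update)
qed

lemma gt_Recv:
  assumes "p \<notin> nplays N" and "fmlookup Ps k = Some P" and "\<forall>l \<in> fmdom' Ps. k \<le> l"
  shows "gt (p\<lbrakk>Recv q Ps\<rbrakk> \<parallel> N) (p # qs) =
    GIn q p (fmupd k (gt (p\<lbrakk>P\<rbrakk> \<parallel> N) (qs @ [p])) fmempty)"
proof -
  have 1: "p\<lbrakk>P\<rbrakk> \<parallel> (p\<lbrakk>Recv q Ps\<rbrakk> \<parallel> N) = p\<lbrakk>P\<rbrakk> \<parallel> N" for P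
    by (rule poly_mapping_eqI) (simp add: lookup_update)
  have "Min (fmdom' Ps) = k"
    using assms(2,3) by (intro Min_eqI) (auto intro: fmdom'I)
  then have "fmmap f (fmrestrict_set {Min (fmdom' Ps)} Ps) = fmupd k (f P) fmempty"
    for f :: "_ \<Rightarrow> ('a, 'b) gtype"
    using assms(2) by (intro fmap_ext) auto
  then show ?thesis by (subst gt.code) (simp add: lookup_update 1)
qed

end

theory Submission imports Defs begin

text \<open>
  Every subterm of \<open>gt N ps\<close> is \<open>gt M qs\<close> for a network \<open>M\<close> whose components are subterms of those
  of \<open>N\<close> and a list \<open>qs\<close> over \<open>set ps\<close> that is no longer than \<open>ps\<close>. There are finitely many such
  pairs, so \<open>gt N ps\<close> is regular. If \<open>ps\<close> contains all players of \<open>N\<close>, then the players of \<open>gt N ps\<close>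
  are those of \<open>N\<close>: none is ever invented, and each gets its turn because the list is a queue.
  This is the condition on players in the typing rules, so the pairs \<open>(gt N ps, N)\<close> with
  \<open>nplays N \<subseteq> set ps\<close> are closed under these rules backwards.
\<close>

section \<open>Subterms of processes\<close>

lemma subproc_trans: "subproc Q P \<Longrightarrow> subproc R Q \<Longrightarrow> subproc R P"
  by (induction rule: subproc.induct) (auto intro: subproc.intros)

lemma subproc_Inact [simp]: "subproc Q Inact \<longleftrightarrow> Q = Inact"
  by (auto elim: subproc.cases intro: subproc.intros)

lemma process_Inact: "process Inact"
  by (simp add: process_def)

lemma partners_Inact: "partners Inact = {}"
  by (simp add: partners_def)

lemma finite_subproc: "process P \<Longrightarrow> finite {Q. subproc Q P}"
  by (simp add: process_def)

lemma process_nonempty: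
  "process (Send q Ps) \<Longrightarrow> Ps \<noteq> fmempty"
  "process (Recv q Ps) \<Longrightarrow> Ps \<noteq> fmempty"
  by (auto simp: process_def intro: subproc_refl)

lemma process_subproc:
  assumes "process P" "subproc Q P"
  shows "process Q"
proof -
  have *: "subproc R P" if "subproc R Q" for R
    using assms(2) that by (rule subproc_trans)
  then have "finite {R. subproc R Q}"
    by (intro finite_subset[OF _ finite_subproc[OF assms(1)]]) blast
  with * assms(1) show ?thesis
    unfolding process_def by blast
qed

section \<open>Networks of subterms\<close>

lemma lookup_net:
  "Poly_Mapping.lookup (net C) p = Inact \<or> (p, Poly_Mapping.lookup (net C) p) \<in> set C"
  by (induction C rule: net.induct) (auto simp: lookup_update zero_proc_def)

lemma nplays_net: "nplays (net C) \<subseteq> set (map fst C)"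
  using lookup_net[of C] by (force simp: in_keys_iff zero_proc_def)

text \<open>Together with \<open>update_update\<close> this splits \<open>N\<close> into the
  component of \<open>p\<close> and the rest, as the typing rules require.\<close>

lemma update_lookup: "Poly_Mapping.lookup N p = P \<Longrightarrow> p\<lbrakk>P\<rbrakk> \<parallel> N = N"
  by (rule poly_mapping_eqI) (auto simp: lookup_update)

lemma update_update [simp]: "p\<lbrakk>P\<rbrakk> \<parallel> (p\<lbrakk>Q\<rbrakk> \<parallel> N) = p\<lbrakk>P\<rbrakk> \<parallel> N"
  by (rule poly_mapping_eqI) (simp add: lookup_update)

text \<open>Every network met while unfolding \<open>gt N ps\<close> lies below \<open>N\<close> in
  this componentwise subterm order.\<close>

definition descends :: "('p, 'l) network \<Rightarrow> ('p, 'l) network \<Rightarrow> bool" where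
  "descends M N \<longleftrightarrow> (\<forall>p. subproc (Poly_Mapping.lookup M p) (Poly_Mapping.lookup N p))"

lemma descends_refl: "descends N N"
  by (simp add: descends_def subproc_refl)

lemma descends_trans: "descends L M \<Longrightarrow> descends M N \<Longrightarrow> descends L N"
  unfolding descends_def using subproc_trans by blast

lemma descends_update:
  assumes "Poly_Mapping.lookup N p = Send q Ps \<or> Poly_Mapping.lookup N p = Recv q Ps"
    and "fmlookup Ps l = Some P"
  shows "descends (p\<lbrakk>P\<rbrakk> \<parallel> N) N"
  using assms by (auto simp: descends_def lookup_update intro: subproc_refl subproc_Send[OF _ subproc_refl]
      subproc_Recv[OF _ subproc_refl])

text \<open>\<open>Inact\<close> has no proper subterm, so a participant that has stopped never
  becomes active again.\<close>

lemma descends_nplays: "descends M N \<Longrightarrow> nplays M \<subseteq> nplays N"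
  by (auto simp: descends_def in_keys_iff zero_proc_def) (metis subproc_Inact)

definition processes :: "('p, 'l) network \<Rightarrow> bool" where
  "processes N \<longleftrightarrow> (\<forall>p. process (Poly_Mapping.lookup N p))"

lemma processes_descends: "processes N \<Longrightarrow> descends M N \<Longrightarrow> processes M"
  unfolding processes_def descends_def using process_subproc by blast

text \<open>A network is determined by its lookup function, which here is \<open>Inact\<close> off
  \<open>nplays N\<close> and elsewhere takes values in a finite set of subterms; there are finitely
  many such functions.\<close>

lemma finite_descends:
  assumes "processes N"
  shows "finite {M. descends M N}"
proof -
  let ?B = "\<Union>p \<in> nplays N. {Q. subproc Q (Poly_Mapping.lookup N p)}"
  let ?F = "{f. \<forall>p. (p \<in> nplays N \<longrightarrow> f p \<in> ?B) \<and> (p \<notin> nplays N \<longrightarrow> f p = Inact)}"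
  have "finite ?B"
    using assms by (auto simp: processes_def intro: finite_subproc)
  then have "finite ?F"
    by (intro finite_set_of_finite_funs) auto
  moreover have "Poly_Mapping.lookup ` {M. descends M N} \<subseteq> ?F"
    by (auto simp: descends_def in_keys_iff zero_proc_def) (metis subproc_Inact)
  ultimately have "finite (Poly_Mapping.lookup ` {M. descends M N})"
    by (rule rev_finite_subset)
  then show ?thesis
    by (rule finite_imageD) (simp add: inj_on_def lookup_inject)
qed

section \<open>The global type of a network\<close>

lemma gt_Cons_Send:
  assumes "Poly_Mapping.lookup N p = Send q Ps"
  shows "gt N (p # qs) = GOut p q (fmmap (\<lambda>P. gt (p\<lbrakk>P\<rbrakk> \<parallel> N) (qs @ [p])) Ps)"
  by (subst gt.code) (simp add: assms)

lemma gt_Cons_Recv: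
  assumes "Poly_Mapping.lookup N p = Recv q Ps" "Ps \<noteq> fmempty"
  obtains k P where "fmlookup Ps k = Some P"
    and "gt N (p # qs) = GIn q p (fmupd k (gt (p\<lbrakk>P\<rbrakk> \<parallel> N) (qs @ [p])) fmempty)"
proof -
  let ?k = "Min (fmdom' Ps)"
  have "fmdom' Ps \<noteq> {}"
    \<comment> \<open>A map equals its restriction to its own domain, so an empty domain would make
      it empty.\<close>
    using assms(2) by (metis fmrestrict_set_dom fmrestrict_set_null)
  then have "?k \<in> fmdom' Ps"
    by simp
  then obtain P where P: "fmlookup Ps ?k = Some P"
    by (metis fmlookup_dom'_iff)
  then have "fmmap f (fmrestrict_set {?k} Ps) = fmupd ?k (f P) fmempty"
    for f :: "_ \<Rightarrow> ('a, 'b) gtype"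
    by (intro fmap_ext) auto
  then show thesis
    using P that by (subst (asm) gt.code) (simp add: assms(1))
qed

text \<open>Skipping the inactive participants at the head of \<open>ps\<close> exposes the first
  communication. What follows its player is \<open>qs\<close>, strictly shorter than
  \<open>ps\<close>, which leaves room to requeue \<open>p\<close>. Only non-players are skipped, so
  no player of \<open>N\<close> in \<open>ps\<close> is lost.\<close>

lemma gt_cases:
  assumes "processes N"
  obtains (End) "gt N ps = End" "nplays N \<inter> set ps = {}"
  | (Send) p q Ps qs where "Poly_Mapping.lookup N p = Send q Ps" "Ps \<noteq> fmempty"
      "gt N ps = GOut p q (fmmap (\<lambda>P. gt (p\<lbrakk>P\<rbrakk> \<parallel> N) (qs @ [p])) Ps)"
      "set (p # qs) \<subseteq> set ps" "length qs < length ps" "nplays N \<inter> set ps \<subseteq> set (p # qs)"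
  | (Recv) p q Ps k P qs where "Poly_Mapping.lookup N p = Recv q Ps" "fmlookup Ps k = Some P"
      "gt N ps = GIn q p (fmupd k (gt (p\<lbrakk>P\<rbrakk> \<parallel> N) (qs @ [p])) fmempty)"
      "set (p # qs) \<subseteq> set ps" "length qs < length ps" "nplays N \<inter> set ps \<subseteq> set (p # qs)"
proof (induction ps arbitrary: thesis)
  case Nil
  then show ?case by (simp add: gt_Nil)
next
  case (Cons p ps)
  show ?case
  proof (cases "Poly_Mapping.lookup N p")
    case Inact
    \<comment> \<open>An inactive head affects neither \<open>gt\<close> nor the players in the
      list, so the cases for the tail carry over.\<close>
    then have *: "gt N (p # ps) = gt N ps" "nplays N \<inter> set (p # ps) = nplays N \<inter> set ps"
      by (auto simp: gt_Inact in_keys_iff zero_proc_def)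
    show ?thesis
    proof (rule Cons.IH, goal_cases)
      case 1
      then show ?case using Cons.prems(1) * by simp
    next
      case 2
      show ?case by (rule Cons.prems(2)) (use 2 * in auto)
    next
      case 3
      show ?case by (rule Cons.prems(3)) (use 3 * in auto)
    qed
  next
    case (Send q Ps)
    then have "Ps \<noteq> fmempty"
      using assms process_nonempty(1) unfolding processes_def by metis
    with Send show ?thesis
      by (intro Cons.prems(2)[OF Send _ gt_Cons_Send[OF Send]]) auto
  next
    case (Recv q Ps)
    then have "Ps \<noteq> fmempty"
      using assms process_nonempty(2) unfolding processes_def by metis
    from gt_Cons_Recv[OF Recv this, of ps] obtain k P where "fmlookup Ps k = Some P"
      "gt N (p # ps) = GIn q p (fmupd k (gt (p\<lbrakk>P\<rbrakk> \<parallel> N) (ps @ [p])) fmempty)"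
      by blast
    then show ?thesis
      by (rule Cons.prems(3)[OF Recv]) auto
  qed
qed

section \<open>Regularity and well-formedness of the global type\<close>

text \<open>A communication replaces one component by a subterm and requeues its player, which
  neither lengthens the list nor adds a name to it.\<close>

lemma subgtype_gt:
  assumes "subgtype H (gt N ps)" "processes N"
  shows "\<exists>M qs. H = gt M qs \<and> descends M N \<and> set qs \<subseteq> set ps \<and> length qs \<le> length ps"
  using assms
proof (induction H "gt N ps" arbitrary: N ps rule: subgtype.induct)
  case subgtype_refl
  then show ?case using descends_refl by blast
next
  case (subgtype_GOut Gs l G H p q)
  from \<open>processes N\<close> show ?case
  proof (cases rule: gt_cases[where ps = ps])
    case (Send p' q' Ps qs)
    with subgtype_GOut obtain P where P: "fmlookup Ps l = Some P" "G = gt (p'\<lbrakk>P\<rbrakk> \<parallel> N) (qs @ [p'])"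
      by auto
    with Send have d: "descends (p'\<lbrakk>P\<rbrakk> \<parallel> N) N"
      by (blast intro: descends_update)
    with subgtype_GOut.hyps(3)[OF P(2)] \<open>processes N\<close> obtain M rs where
      "H = gt M rs" "descends M (p'\<lbrakk>P\<rbrakk> \<parallel> N)" "set rs \<subseteq> set (qs @ [p'])" "length rs \<le> length (qs @ [p'])"
      using processes_descends by blast
    with d Send show ?thesis
      by (intro exI[of _ M] exI[of _ rs]) (auto intro: descends_trans)
  qed (use subgtype_GOut in simp_all)
next
  case (subgtype_GIn Gs l G H p q)
  from \<open>processes N\<close> show ?case
  proof (cases rule: gt_cases[where ps = ps])
    case (Recv p' q' Ps k P qs)
    with subgtype_GIn have G: "G = gt (p'\<lbrakk>P\<rbrakk> \<parallel> N) (qs @ [p'])"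
      by (auto split: if_splits)
    from Recv have d: "descends (p'\<lbrakk>P\<rbrakk> \<parallel> N) N"
      by (blast intro: descends_update)
    with subgtype_GIn.hyps(3)[OF G] \<open>processes N\<close> obtain M rs where
      "H = gt M rs" "descends M (p'\<lbrakk>P\<rbrakk> \<parallel> N)" "set rs \<subseteq> set (qs @ [p'])" "length rs \<le> length (qs @ [p'])"
      using processes_descends by blast
    with d Recv show ?thesis
      by (intro exI[of _ M] exI[of _ rs]) (auto intro: descends_trans)
  qed (use subgtype_GIn in simp_all)
qed

lemma finite_subgtype_gt:
  assumes "processes N"
  shows "finite {H. subgtype H (gt N ps)}"
proof (rule finite_subset)
  let ?L = "{qs. set qs \<subseteq> set ps \<and> length qs \<le> length ps}"
  show "{H. subgtype H (gt N ps)} \<subseteq> case_prod gt ` ({M. descends M N} \<times> ?L)"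
    using subgtype_gt[OF _ assms] by force
  show "finite (case_prod gt ` ({M. descends M N} \<times> ?L))"
    using assms by (intro finite_imageI finite_cartesian_product finite_descends
        finite_lists_length_le) auto
qed

text \<open>A choice inside \<open>gt N ps\<close> stems from a component of some \<open>M\<close>
  below \<open>N\<close>. Its partner is therefore among the \<open>partners\<close> of the same
  participant in \<open>N\<close>, and so differs from that participant.\<close>

lemma global_type_gt:
  assumes "processes N" "\<And>p. p \<notin> partners (Poly_Mapping.lookup N p)"
  shows "global_type (gt N ps)"
proof -
  have "p \<noteq> q \<and> Gs \<noteq> fmempty"
    if H: "subgtype H (gt N ps)" "H = GOut p q Gs \<or> H = GIn p q Gs" for H p q Gs
  proof -
    from subgtype_gt[OF H(1) assms(1)] obtain M qs where M: "H = gt M qs" "descends M N"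
      by blast
    have neq: "r \<noteq> s" if "Poly_Mapping.lookup M r = Send s Ps \<or> Poly_Mapping.lookup M r = Recv s Ps"
      for r s Ps
      using that M(2) assms(2)[of r] unfolding descends_def partners_def
      by (metis (mono_tags, lifting) mem_Collect_eq)
    from assms(1) M(2) have "processes M"
      by (rule processes_descends)
    then show ?thesis
    proof (cases rule: gt_cases[where ps = qs])
      case (Send r s Ps rs)
      then have "fmmap (\<lambda>P. gt (r\<lbrakk>P\<rbrakk> \<parallel> M) (rs @ [r])) Ps \<noteq> fmempty"
        by (metis fmdom_map fmdom_empty fmrestrict_fset_dom fmrestrict_fset_null)
      with Send H M neq show ?thesis by auto
    next
      case (Recv r s Ps k P rs)
      have "fmupd k (gt (r\<lbrakk>P\<rbrakk> \<parallel> M) (rs @ [r])) fmempty \<noteq> fmempty"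
        by (metis fmempty_lookup fmupd_lookup option.distinct(1))
      with Recv H M neq show ?thesis by auto
    qed (use H M in auto)
  qed
  with finite_subgtype_gt[OF assms(1)] show ?thesis
    unfolding global_type_def by blast
qed

section \<open>Players of the global type\<close>

text \<open>The player of the first communication is active in \<open>N\<close>; the later ones are
  active in networks below \<open>N\<close>, which have no new players.\<close>

lemma in_plays_gt_imp:
  assumes "in_plays r (gt N ps)" "processes N"
  shows "r \<in> nplays N"
  using assms
proof (induction r "gt N ps" arbitrary: N ps rule: in_plays.induct)
  case (1 p q Gs)
  from \<open>processes N\<close> show ?case
    by (cases rule: gt_cases[where ps = ps]) (use 1 in \<open>auto simp: in_keys_iff zero_proc_def\<close>)
next
  case (2 q p Gs)
  from \<open>processes N\<close> show ?case
    by (cases rule: gt_cases[where ps = ps]) (use 2 in \<open>auto simp: in_keys_iff zero_proc_def\<close>)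
next
  case (3 Gs l G r p q)
  from \<open>processes N\<close> show ?case
  proof (cases rule: gt_cases[where ps = ps])
    case (Send p' q' Ps qs)
    with 3 obtain P where P: "fmlookup Ps l = Some P" "G = gt (p'\<lbrakk>P\<rbrakk> \<parallel> N) (qs @ [p'])"
      by auto
    with Send have "descends (p'\<lbrakk>P\<rbrakk> \<parallel> N) N"
      by (blast intro: descends_update)
    with "3.hyps"(3)[OF P(2)] \<open>processes N\<close> show ?thesis
      using processes_descends descends_nplays by blast
  qed (use 3 in simp_all)
next
  case (4 Gs l G r p q)
  from \<open>processes N\<close> show ?case
  proof (cases rule: gt_cases[where ps = ps])
    case (Recv p' q' Ps k P qs)
    with 4 have G: "G = gt (p'\<lbrakk>P\<rbrakk> \<parallel> N) (qs @ [p'])"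
      by (auto split: if_splits)
    from Recv have "descends (p'\<lbrakk>P\<rbrakk> \<parallel> N) N"
      by (blast intro: descends_update)
    with "4.hyps"(3)[OF G] \<open>processes N\<close> show ?thesis
      using processes_descends descends_nplays by blast
  qed (use 4 in simp_all)
qed

text \<open>Induction on the queue \<open>xs\<close> in front of \<open>r\<close>: its head is
  either dropped or requeued behind \<open>r\<close>, so \<open>r\<close> moves forward. One
  continuation suffices at each choice, and nonemptiness provides it.\<close>

lemma in_plays_gt:
  assumes "r \<in> nplays N" "processes N"
  shows "in_plays r (gt N (xs @ r # ys))"
  using assms
proof (induction xs arbitrary: N ys)
  case Nil
  show ?case
  proof (cases "Poly_Mapping.lookup N r")
    case Inact
    with Nil show ?thesis by (simp add: in_keys_iff zero_proc_def)
  next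
    case (Send q Ps)
    then show ?thesis by (simp add: gt_Cons_Send in_plays.intros(1))
  next
    case (Recv q Ps)
    with Nil have "Ps \<noteq> fmempty"
      using process_nonempty(2) unfolding processes_def by metis
    from gt_Cons_Recv[OF Recv this, of ys] show ?thesis
      using in_plays.intros(2) by (metis append_Nil)
  qed
next
  case (Cons x xs)
  \<comment> \<open>The requeued \<open>x\<close> is absorbed into the part behind \<open>r\<close>,
    which becomes \<open>ys @ [x]\<close>; since \<open>r\<close> is not \<open>x\<close>, its
    component is unchanged.\<close>
  have IH: "in_plays r (gt (x\<lbrakk>P\<rbrakk> \<parallel> N) ((xs @ r # ys) @ [x]))"
    if "r \<noteq> x" "descends (x\<lbrakk>P\<rbrakk> \<parallel> N) N" for P
    using Cons.IH[of "x\<lbrakk>P\<rbrakk> \<parallel> N" "ys @ [x]"] processes_descends[OF Cons.prems(2) that(2)]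
      that(1) Cons.prems(1)
    by (simp add: in_keys_iff lookup_update)
  show ?case
  proof (cases "Poly_Mapping.lookup N x")
    case Inact
    with Cons show ?thesis by (simp add: gt_Inact)
  next
    case (Send q Ps)
    then have "Ps \<noteq> fmempty"
      using Cons.prems process_nonempty(1) unfolding processes_def by metis
    then obtain l P where l: "fmlookup Ps l = Some P"
      by (metis fmap_ext fmempty_lookup not_Some_eq)
    with Send have "descends (x\<lbrakk>P\<rbrakk> \<parallel> N) N"
      by (blast intro: descends_update)
    with IH l Send show ?thesis
      by (cases "r = x") (auto simp: gt_Cons_Send intro: in_plays.intros(1) in_plays.intros(3)[of _ l])
  next
    case (Recv q Ps)
    then have "Ps \<noteq> fmempty"
      using Cons.prems process_nonempty(2) unfolding processes_def by metis
    from gt_Cons_Recv[OF Recv this, of "xs @ r # ys"] obtain k P where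
      k: "fmlookup Ps k = Some P" and
      gt: "gt N (x # xs @ r # ys) = GIn q x (fmupd k (gt (x\<lbrakk>P\<rbrakk> \<parallel> N) ((xs @ r # ys) @ [x])) fmempty)"
      by blast
    from k Recv have "descends (x\<lbrakk>P\<rbrakk> \<parallel> N) N"
      by (blast intro: descends_update)
    with IH gt show ?thesis
      by (cases "r = x") (auto intro: in_plays.intros(2) in_plays.intros(4)[of _ k])
  qed
qed

lemma gplays_gt:
  assumes "processes N" "nplays N \<subseteq> set ps"
  shows "gplays (gt N ps) = nplays N"
proof -
  have "in_plays r (gt N ps)" if "r \<in> nplays N" for r
  proof -
    from that assms(2) obtain xs ys where "ps = xs @ r # ys"
      by (meson split_list subsetD)
    with that assms(1) show ?thesis
      by (simp add: in_plays_gt)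
  qed
  moreover have "r \<in> nplays N" if "in_plays r (gt N ps)" for r
    using that assms(1) by (rule in_plays_gt_imp)
  ultimately show ?thesis
    unfolding gplays_def by blast
qed

section \<open>The typing derivation\<close>

text \<open>The inclusion of players in the list is used twice: where the unfolding ends it forces
  the network to be empty, and at a choice it gives the condition on players through
  \<open>gplays_gt\<close>.\<close>

lemma typing_gt:
  assumes "processes N" "nplays N \<subseteq> set ps"
  shows "\<turnstile> gt N ps \<triangleright> N"
  using assms
proof (coinduction arbitrary: N ps rule: typing.coinduct)
  case (typing N ps)
  \<comment> \<open>Setting \<open>p\<close> to \<open>Inact\<close> deletes its component; the
    result serves as the remaining network in both rules.\<close>
  have step: "p \<notin> nplays (p\<lbrakk>Inact\<rbrakk> \<parallel> N)" for p
    by (simp add: in_keys_iff lookup_update zero_proc_def)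
  have cont: "processes (p\<lbrakk>P\<rbrakk> \<parallel> N)" "nplays (p\<lbrakk>P\<rbrakk> \<parallel> N) \<subseteq> set (qs @ [p])"
    "gplays (gt (p\<lbrakk>P\<rbrakk> \<parallel> N) (qs @ [p])) - {p} = nplays (p\<lbrakk>Inact\<rbrakk> \<parallel> N)"
    if "Poly_Mapping.lookup N p = Send q Ps \<or> Poly_Mapping.lookup N p = Recv q Ps"
      "fmlookup Ps l = Some P" "nplays N \<inter> set ps \<subseteq> set (p # qs)" for p q Ps l P qs
  proof -
    have d: "descends (p\<lbrakk>P\<rbrakk> \<parallel> N) N"
      using that by (intro descends_update)
    show 1: "processes (p\<lbrakk>P\<rbrakk> \<parallel> N)"
      using typing(1) d by (rule processes_descends)
    show 2: "nplays (p\<lbrakk>P\<rbrakk> \<parallel> N) \<subseteq> set (qs @ [p])"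
      using descends_nplays[OF d] typing(2) that(3) by auto
    show "gplays (gt (p\<lbrakk>P\<rbrakk> \<parallel> N) (qs @ [p])) - {p} = nplays (p\<lbrakk>Inact\<rbrakk> \<parallel> N)"
      \<comment> \<open>Subtracting \<open>{p}\<close> leaves the other players, whether or not the
        continuation \<open>P\<close> is \<open>Inact\<close>.\<close>
      unfolding gplays_gt[OF 1 2] by (auto simp: in_keys_iff lookup_update zero_proc_def split: if_splits)
  qed
  from typing(1) show ?case
  proof (cases rule: gt_cases[where ps = ps])
    case End
    \<comment> \<open>\<open>nplays N\<close> is both contained in \<open>set ps\<close> and
      disjoint from it.\<close>
    with typing(2) have "N = 0"
      by (simp add: inf.absorb1)
    \<comment> \<open>The empty network is the class of every inactive component, so any participant
      can serve as witness.\<close>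
    then have "N = undefined\<lbrakk>Inact\<rbrakk> \<parallel> 0"
      by (simp add: update_lookup zero_proc_def)
    with End(1) show ?thesis
      by (intro disjI1 exI conjI)
  next
    case (Send p q Ps qs)
    let ?Gs = "fmmap (\<lambda>P. gt (p\<lbrakk>P\<rbrakk> \<parallel> N) (qs @ [p])) Ps"
    have N: "N = p\<lbrakk>Send q Ps\<rbrakk> \<parallel> (p\<lbrakk>Inact\<rbrakk> \<parallel> N)"
      using Send(1) by (simp add: update_lookup)
    have Gs: "?Gs \<noteq> fmempty" "fmdom ?Gs = fmdom Ps"
      using Send(2) by (simp_all, metis fmdom_map fmdom_empty fmrestrict_fset_dom fmrestrict_fset_null)
    have H: "H = gt (p\<lbrakk>P\<rbrakk> \<parallel> N) (qs @ [p])"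
      if "fmlookup ?Gs l = Some H" "fmlookup Ps l = Some P" for l H P
      using that by simp
    note c = cont[OF disjI1[OF Send(1)] _ Send(6)]
    show ?thesis
    proof (rule disjI2, rule disjI1, rule exI[of _ p], rule exI[of _ "p\<lbrakk>Inact\<rbrakk> \<parallel> N"],
        rule exI[of _ ?Gs], rule exI[of _ Ps], rule exI[of _ q],
        intro conjI allI impI Gs Send(3) N step, unfold update_update, goal_cases)
      case (1 l H P)
      show ?case
        using H[OF 1] c(1,2)[OF 1(2)] by blast
    next
      case (2 l H P)
      show ?case
        unfolding H[OF 2] by (rule c(3)[OF 2(2)])
    qed
  next
    case (Recv p q Ps k P qs)
    let ?Gs = "fmupd k (gt (p\<lbrakk>P\<rbrakk> \<parallel> N) (qs @ [p])) fmempty"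
    have N: "N = p\<lbrakk>Recv q Ps\<rbrakk> \<parallel> (p\<lbrakk>Inact\<rbrakk> \<parallel> N)"
      using Recv(1) by (simp add: update_lookup)
    have Gs: "?Gs \<noteq> fmempty" "fmdom ?Gs |\<subseteq>| fmdom Ps"
      \<comment> \<open>Looking up \<open>k\<close> on both sides refutes equality with
        \<open>fmempty\<close>.\<close>
      using Recv(2) by (auto intro: fmdomI dest: arg_cong[of _ _ "\<lambda>m. fmlookup m k"])
    \<comment> \<open>The only label of \<open>?Gs\<close> is \<open>k\<close>, so \<open>l\<close>
      is \<open>k\<close> and \<open>Q\<close> is \<open>P\<close>.\<close>
    have H: "H = gt (p\<lbrakk>Q\<rbrakk> \<parallel> N) (qs @ [p])"
      if "fmlookup ?Gs l = Some H" "fmlookup Ps l = Some Q" for l H Q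
      using that Recv(2) by (simp split: if_splits)
    note c = cont[OF disjI2[OF Recv(1)] _ Recv(6)]
    show ?thesis
    proof (rule disjI2, rule disjI2, rule exI[of _ p], rule exI[of _ "p\<lbrakk>Inact\<rbrakk> \<parallel> N"],
        rule exI[of _ ?Gs], rule exI[of _ Ps], rule exI[of _ q],
        intro conjI allI impI Gs Recv(3) N step, unfold update_update, goal_cases)
      case (1 l H Q)
      show ?case
        using H[OF 1] c(1,2)[OF 1(2)] by blast
    next
      case (2 l H Q)
      show ?case
        unfolding H[OF 2] by (rule c(3)[OF 2(2)])
    qed
  qed
qed

text \<open>Networks may contain self-communication, whereas a global type needs distinct sender and
  receiver; hence the second conjunct is conditional on no participant being its own
  partner.\<close>

theorem theorem3p8:
  fixes C :: "('p \<times> ('p, 'l::linorder) proc) list"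
  assumes "C \<noteq> []"
    and "distinct (map fst C)"
    and "\<forall>(p, P) \<in> set C. process P"
  shows "(\<turnstile> gt (net C) (map fst C) \<triangleright> net C) \<and>
    ((\<forall>(p, P) \<in> set C. p \<notin> partners P) \<longrightarrow> global_type (gt (net C) (map fst C)))"
proof (intro conjI impI)
  have N: "processes (net C)"
    unfolding processes_def
  proof
    fix p
    show "process (Poly_Mapping.lookup (net C) p)"
      using lookup_net[of C p] assms(3) process_Inact by auto
  qed
  then show "\<turnstile> gt (net C) (map fst C) \<triangleright> net C"
    using nplays_net by (rule typing_gt)
  assume "\<forall>(p, P) \<in> set C. p \<notin> partners P"
  then have "p \<notin> partners (Poly_Mapping.lookup (net C) p)" for p
    using lookup_net[of C p] partners_Inact by auto
  with N show "global_type (gt (net C) (map fst C))"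
    by (rule global_type_gt)
qed

end
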